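(* For an integer $k \geq 2$, let \begin{align*} A^* &= \{0,2\} \cup \{3,7,11,\ldots,4k-1\} \cup \{9,13,17,\ldots,4k+5\} \cup \{4k+6, 4k+8\} \\ &= \{0,2\} \cup \{3+6x_1+4x_2 : 0 \leq x_1 \leq 1 \text{ and } 0 \leq x_2 \leq k-1\} \cup \big((4k+8) - \{0,2\}\big), \end{align*} where $x_1,x_2$ range over integers, and let $A = A^* \cup \{4\}$. Then $A$ is an MSTD set of integers, i.e. $|A+A| > |A-A|$.
   Context: For sets $A,B$ of integers, $A+B=\{a+b : a\in A, b\in B\}$, $A-B=\{a-b : a\in A, b\in B\}$, and for an integer $x$, $x - B = \{x-b : b\in B\}$. $|A|$ denotes cardinality. A finite set $A$ is called an MSTD set (more sums than differences) if $|A+A|>|A-A|$. *)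

theory Defs
  imports Main "HOL-Library.Set_Algebras"
begin

(* The sumset A + B is the one of HOL-Library.Set_Algebras.  On sets, "-" is set-theoretic
   difference, so the difference set needs a name of its own. *)

definition diff_set :: "int set \<Rightarrow> int set \<Rightarrow> int set" where
  "diff_set A B = {a - b | a b. a \<in> A \<and> b \<in> B}"

definition reflect :: "int \<Rightarrow> int set \<Rightarrow> int set" where
  "reflect x B = {x - b | b. b \<in> B}"

definition MSTD :: "int set \<Rightarrow> bool" where
  "MSTD A \<longleftrightarrow> finite A \<and> card (A + A) > card (diff_set A A)"

(* arith_prog a d b is {a, a + d, a + 2d, ..., b}. *)
definition arith_prog :: "int \<Rightarrow> int \<Rightarrow> int \<Rightarrow> int set" where
  "arith_prog a d b = {a + int j * d | j. a + int j * d \<le> b}"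

definition A_star :: "int \<Rightarrow> int set" where
  "A_star k = {0, 2} \<union> arith_prog 3 4 (4 * k - 1) \<union> arith_prog 9 4 (4 * k + 5)
     \<union> {4 * k + 6, 4 * k + 8}"

end

theory Submission
  imports Defs
begin

text \<open>
  Write \<open>A\<close> for the set in question and put \<open>n = 4k + 8\<close>, so that \<open>A\<close> lies in \<open>[0, n]\<close>.

  Differences: \<open>A - A\<close> lies in \<open>[-n, n]\<close> and misses the four values \<open>\<plusminus>(n - 1)\<close> and \<open>\<plusminus>4k\<close>
  (lemma \<open>diff_set_subset\<close>). For \<open>n - 1\<close> the reason is that neither \<open>1\<close> nor \<open>n - 1\<close> is in \<open>A\<close>. For
  \<open>4k\<close> it is seen modulo 4: a positive difference divisible by 4 comes from two elements of the
  same progression, whose differences are at most \<open>4k - 4\<close>, or from two of the even elements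
  \<open>0, 2, 4, 4k + 6, 4k + 8\<close>, whose differences are at most 4 or at least \<open>4k + 2\<close>.
  Hence \<open>|A - A| \<le> 2n - 3\<close>.

  Sums: \<open>A + A\<close> contains everything in \<open>[0, 2n]\<close> except possibly the three values \<open>1\<close>,
  \<open>2n - 8 = 8k + 8\<close> and \<open>2n - 1\<close> (lemma \<open>sumset_supset\<close>). The additional element 4 provides the
  sum \<open>8 = 4 + 4\<close>, whose mirror image \<open>2n - 8\<close> is the value that is lost; this is the asymmetry
  that differences cannot have. Hence \<open>|A + A| \<ge> 2n - 2\<close>.
\<close>

lemma mem_arith_prog_4:
  "x \<in> arith_prog a 4 b \<longleftrightarrow> a \<le> x \<and> x \<le> b \<and> (x - a) mod 4 = 0"
proof
  assume R: "a \<le> x \<and> x \<le> b \<and> (x - a) mod 4 = 0"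
  define j where "j = nat ((x - a) div 4)"
  have "int j = (x - a) div 4"
    using R unfolding j_def by (simp add: pos_imp_zdiv_nonneg_iff)
  then have "x = a + int j * 4"
    using R by presburger
  then show "x \<in> arith_prog a 4 b"
    using R unfolding arith_prog_def by blast
qed (auto simp: arith_prog_def)

lemma mem_A:
  "x \<in> A_star k \<union> {4} \<longleftrightarrow>
     x \<in> {0, 2, 4, 4 * k + 6, 4 * k + 8}
     \<or> (3 \<le> x \<and> x \<le> 4 * k - 1 \<and> x mod 4 = 3)
     \<or> (9 \<le> x \<and> x \<le> 4 * k + 5 \<and> x mod 4 = 1)"
proof -
  have "(x - 3) mod 4 = 0 \<longleftrightarrow> x mod 4 = 3" "(x - 9) mod 4 = 0 \<longleftrightarrow> x mod 4 = 1"
    by presburger+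
  then show ?thesis
    unfolding A_star_def by (auto simp: mem_arith_prog_4)
qed

lemma A_star_eq:
  "A_star k = {0, 2}
     \<union> {3 + 6 * x1 + 4 * x2 | x1 x2. 0 \<le> x1 \<and> x1 \<le> 1 \<and> 0 \<le> x2 \<and> x2 \<le> k - 1}
     \<union> reflect (4 * k + 8) {0, 2}"
proof -
  have "x \<in> arith_prog 3 4 (4 * k - 1) \<union> arith_prog 9 4 (4 * k + 5) \<longleftrightarrow>
      (\<exists>x1 x2. x = 3 + 6 * x1 + 4 * x2 \<and> 0 \<le> x1 \<and> x1 \<le> 1 \<and> 0 \<le> x2 \<and> x2 \<le> k - 1)" for x
  proof -
    have two: "(\<exists>x1::int. 0 \<le> x1 \<and> x1 \<le> 1 \<and> P x1) \<longleftrightarrow> P 0 \<or> P 1" for P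
    proof -
      have "0 \<le> x1 \<and> x1 \<le> 1 \<longleftrightarrow> x1 = 0 \<or> x1 = 1" for x1 :: int
        by presburger
      then show ?thesis by metis
    qed
    have "(3 \<le> x \<and> x \<le> 4 * k - 1 \<and> (x - 3) mod 4 = 0) \<longleftrightarrow>
        (\<exists>x2. x = 3 + 4 * x2 \<and> 0 \<le> x2 \<and> x2 \<le> k - 1)"
      by presburger
    moreover have "(9 \<le> x \<and> x \<le> 4 * k + 5 \<and> (x - 9) mod 4 = 0) \<longleftrightarrow>
        (\<exists>x2. x = 9 + 4 * x2 \<and> 0 \<le> x2 \<and> x2 \<le> k - 1)"
      by presburger
    moreover have "(\<exists>x1 x2. x = 3 + 6 * x1 + 4 * x2 \<and> 0 \<le> x1 \<and> x1 \<le> 1 \<and> 0 \<le> x2 \<and> x2 \<le> k - 1)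
        \<longleftrightarrow> (\<exists>x1. 0 \<le> x1 \<and> x1 \<le> 1 \<and> (\<exists>x2. x = 3 + 6 * x1 + 4 * x2 \<and> 0 \<le> x2 \<and> x2 \<le> k - 1))"
      by blast
    ultimately show ?thesis
      by (simp add: mem_arith_prog_4 two)
  qed
  then have "arith_prog 3 4 (4 * k - 1) \<union> arith_prog 9 4 (4 * k + 5) =
      {3 + 6 * x1 + 4 * x2 | x1 x2. 0 \<le> x1 \<and> x1 \<le> 1 \<and> 0 \<le> x2 \<and> x2 \<le> k - 1}"
    by blast
  moreover have "reflect (4 * k + 8) {0, 2} = {4 * k + 6, 4 * k + 8}"
    unfolding reflect_def by auto
  ultimately show ?thesis
    unfolding A_star_def by blast
qed

lemma diff_set_subset:
  fixes k :: int
  assumes "k \<ge> 2"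
  defines "A \<equiv> A_star k \<union> {4}"
  shows "diff_set A A \<subseteq>
    {-(4 * k + 8)..4 * k + 8} - {4 * k + 7, -(4 * k + 7), 4 * k, -(4 * k)}"
proof -
  have bounds: "0 \<le> a \<and> a \<le> 4 * k + 8" if "a \<in> A" for a
    using that assms(1) unfolding A_def mem_A by auto
  have near_max: "a - b \<noteq> 4 * k + 7" if "a \<in> A" "b \<in> A" for a b
    using that assms(1) unfolding A_def mem_A by auto
  have no_4k: "a - b \<noteq> 4 * k" if "a \<in> A" "b \<in> A" for a b
    using that assms(1) unfolding A_def mem_A by auto presburger+
  show ?thesis
  proof
    fix d assume "d \<in> diff_set A A"
    then obtain a b where "d = a - b" "a \<in> A" "b \<in> A"
      unfolding diff_set_def by blast
    with bounds[of a] bounds[of b] near_max[of a b] near_max[of b a]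
      no_4k[of a b] no_4k[of b a]
    show "d \<in> {-(4 * k + 8)..4 * k + 8} - {4 * k + 7, -(4 * k + 7), 4 * k, -(4 * k)}"
      by auto
  qed
qed

text \<open>
  Let \<open>P\<close> and \<open>Q\<close> denote the progressions \<open>3, 7, \<dots>, 4k - 1\<close> and \<open>9, 13, \<dots>, 4k + 5\<close>. The
  residue classes 0, 1, 2, 3 modulo 4 are covered, in this order, by \<open>P + Q\<close>, by the
  sums of \<open>0, 4k + 8\<close> with \<open>Q\<close> and of \<open>2, 4k + 6\<close> with \<open>P\<close>, by \<open>P + P\<close> and \<open>Q + Q\<close>, and by the sums of \<open>0, 4, 4k + 8\<close> with \<open>P\<close> and of
  \<open>2, 4k + 6\<close> with \<open>Q\<close>, together with a few sums of two even elements near both ends.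
\<close>

lemma sumset_supset:
  fixes k :: int
  assumes "k \<ge> 2"
  defines "A \<equiv> A_star k \<union> {4}"
  shows "{0..8 * k + 16} - {1, 8 * k + 8, 8 * k + 15} \<subseteq> A + A"
proof
  fix s assume "s \<in> {0..8 * k + 16} - {1, 8 * k + 8, 8 * k + 15}"
  then have range: "0 \<le> s" "s \<le> 8 * k + 16" "s \<noteq> 1" "s \<noteq> 8 * k + 8" "s \<noteq> 8 * k + 15"
    by auto
  have ev: "0 \<in> A" "2 \<in> A" "4 \<in> A" "4 * k + 6 \<in> A" "4 * k + 8 \<in> A"
    unfolding A_def mem_A by auto
  have P: "3 + 4 * j \<in> A" if "0 \<le> j" "j \<le> k - 1" for j
    using that unfolding A_def mem_A by simp
  have Q: "9 + 4 * j \<in> A" if "0 \<le> j" "j \<le> k - 1" for j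
    using that unfolding A_def mem_A by simp
  have sum_eq: "s = a + b \<Longrightarrow> s \<in> A + A" if "a \<in> A" "b \<in> A" for a b
    using that by (simp add: set_plus_intro)
  define m where "m = s div 4"
  consider "s = 4 * m" | "s = 4 * m + 1" | "s = 4 * m + 2" | "s = 4 * m + 3"
    unfolding m_def by atomize_elim presburger
  then show "s \<in> A + A"
  proof cases
    case 1
    note s = this
    have m: "0 \<le> m \<and> m \<le> 2 * k + 4 \<and> m \<noteq> 2 * k + 2"
      using range s by presburger
    consider "m = 0"
      | "m = 1"
      | "m = 2"
      | "3 \<le> m" "m \<le> k + 2"
      | "k + 3 \<le> m" "m \<le> 2 * k + 1"
      | "m = 2 * k + 3"
      | "m = 2 * k + 4"
      using m by fastforce
    then show ?thesis
    proof cases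
      case 1
      then show ?thesis
        using s assms(1) by (intro sum_eq[OF ev(1) ev(1)]) auto
    next
      case 2
      then show ?thesis
        using s assms(1) by (intro sum_eq[OF ev(1) ev(3)]) auto
    next
      case 3
      then show ?thesis
        using s assms(1) by (intro sum_eq[OF ev(3) ev(3)]) auto
    next
      case 4
      then show ?thesis
        using s assms(1) by (intro sum_eq[OF P[of "0"] Q[of "m - 3"]]) auto
    next
      case 5
      then show ?thesis
        using s assms(1) by (intro sum_eq[OF Q[of "k - 1"] P[of "m - k - 2"]]) auto
    next
      case 6
      then show ?thesis
        using s assms(1) by (intro sum_eq[OF ev(4) ev(4)]) auto
    next
      case 7
      then show ?thesis
        using s assms(1) by (intro sum_eq[OF ev(5) ev(5)]) auto
    qed
  next
    case 2
    note s = this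
    have m: "1 \<le> m \<and> m \<le> 2 * k + 3"
      using range s by presburger
    consider "m = 1"
      | "2 \<le> m" "m \<le> k + 1"
      | "k + 2 \<le> m" "m \<le> 2 * k + 1"
      | "m = 2 * k + 2"
      | "m = 2 * k + 3"
      using m by fastforce
    then show ?thesis
    proof cases
      case 1
      then show ?thesis
        using s assms(1) by (intro sum_eq[OF ev(2) P[of "0"]]) auto
    next
      case 2
      then show ?thesis
        using s assms(1) by (intro sum_eq[OF ev(1) Q[of "m - 2"]]) auto
    next
      case 3
      then show ?thesis
        using s assms(1) by (intro sum_eq[OF ev(4) P[of "m - k - 2"]]) auto
    next
      case 4
      then show ?thesis
        using s assms(1) by (intro sum_eq[OF ev(5) Q[of "k - 2"]]) auto
    next
      case 5
      then show ?thesis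
        using s assms(1) by (intro sum_eq[OF ev(5) Q[of "k - 1"]]) auto
    qed
  next
    case 3
    note s = this
    have m: "0 \<le> m \<and> m \<le> 2 * k + 3"
      using range s by presburger
    consider "m = 0"
      | "1 \<le> m" "m \<le> k"
      | "k + 1 \<le> m" "m \<le> 2 * k - 1"
      | "m = 2 * k"
      | "m = 2 * k + 1"
      | "m = 2 * k + 2"
      | "m = 2 * k + 3"
      using m by fastforce
    then show ?thesis
    proof cases
      case 1
      then show ?thesis
        using s assms(1) by (intro sum_eq[OF ev(1) ev(2)]) auto
    next
      case 2
      then show ?thesis
        using s assms(1) by (intro sum_eq[OF P[of "0"] P[of "m - 1"]]) auto
    next
      case 3
      then show ?thesis
        using s assms(1) by (intro sum_eq[OF P[of "k - 1"] P[of "m - k"]]) auto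
    next
      case 4
      then show ?thesis
        using s assms(1) by (intro sum_eq[OF Q[of "k - 2"] Q[of "k - 2"]]) auto
    next
      case 5
      then show ?thesis
        using s assms(1) by (intro sum_eq[OF Q[of "k - 2"] Q[of "k - 1"]]) auto
    next
      case 6
      then show ?thesis
        using s assms(1) by (intro sum_eq[OF Q[of "k - 1"] Q[of "k - 1"]]) auto
    next
      case 7
      then show ?thesis
        using s assms(1) by (intro sum_eq[OF ev(4) ev(5)]) auto
    qed
  next
    case 4
    note s = this
    have m: "0 \<le> m \<and> m \<le> 2 * k + 2"
      using range s by presburger
    consider "0 \<le> m" "m \<le> k - 1"
      | "m = k"
      | "m = k + 1"
      | "k + 2 \<le> m" "m \<le> 2 * k + 1"
      | "m = 2 * k + 2"
      using m by fastforce
    then show ?thesis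
    proof cases
      case 1
      then show ?thesis
        using s assms(1) by (intro sum_eq[OF ev(1) P[of "m"]]) auto
    next
      case 2
      then show ?thesis
        using s assms(1) by (intro sum_eq[OF ev(3) P[of "k - 1"]]) auto
    next
      case 3
      then show ?thesis
        using s assms(1) by (intro sum_eq[OF ev(2) Q[of "k - 1"]]) auto
    next
      case 4
      then show ?thesis
        using s assms(1) by (intro sum_eq[OF ev(5) P[of "m - k - 2"]]) auto
    next
      case 5
      then show ?thesis
        using s assms(1) by (intro sum_eq[OF ev(4) Q[of "k - 1"]]) auto
    qed
  qed
qed

theorem theorem2:
  fixes k :: int
  assumes "k \<ge> 2"
  shows "A_star k = {0, 2}
           \<union> {3 + 6 * x1 + 4 * x2 | x1 x2. 0 \<le> x1 \<and> x1 \<le> 1 \<and> 0 \<le> x2 \<and> x2 \<le> k - 1}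
           \<union> reflect (4 * k + 8) {0, 2}
       \<and> MSTD (A_star k \<union> {4})"
proof
  show "A_star k = {0, 2}
           \<union> {3 + 6 * x1 + 4 * x2 | x1 x2. 0 \<le> x1 \<and> x1 \<le> 1 \<and> 0 \<le> x2 \<and> x2 \<le> k - 1}
           \<union> reflect (4 * k + 8) {0, 2}"
    by (rule A_star_eq)
  define A where "A = A_star k \<union> {4}"
  have "A \<subseteq> {0..4 * k + 8}"
    using assms unfolding A_def by (auto simp only: mem_A subset_iff) auto
  then have fin: "finite A"
    by (rule finite_subset) simp
  have "card (diff_set A A) \<le>
      card ({-(4 * k + 8)..4 * k + 8} - {4 * k + 7, -(4 * k + 7), 4 * k, -(4 * k)})"
    using diff_set_subset[OF assms] unfolding A_def by (intro card_mono) auto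
  also have "\<dots> = card {-(4 * k + 8)..4 * k + 8} - card {4 * k + 7, -(4 * k + 7), 4 * k, -(4 * k)}"
    using assms by (intro card_Diff_subset) auto
  also have "\<dots> = nat (8 * k + 13)"
    using assms by (simp add: nat_diff_distrib)
  also have "\<dots> < nat (8 * k + 14)"
    using assms by simp
  also have "\<dots> = card {0..8 * k + 16} - card {1, 8 * k + 8, 8 * k + 15}"
    using assms by simp
  also have "\<dots> = card ({0..8 * k + 16} - {1, 8 * k + 8, 8 * k + 15})"
    using assms by (intro card_Diff_subset[symmetric]) auto
  also have "\<dots> \<le> card (A + A)"
    using sumset_supset[OF assms] fin unfolding A_def
    by (intro card_mono finite_set_plus) auto
  finally show "MSTD (A_star k \<union> {4})"
    using fin unfolding MSTD_def A_def by simp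
qed

end
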